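(* Let $\mathbf{x}\in(\Sigma^* )^\circ$ and let $\mathbf{y}\in(\Sigma^* )^\circ$ be the gradient certificate of the polynomial $\mathbf{t}-c\mathbf{1}$, i.e. $-g(\mathbf{y})=\mathbf{t}-c\mathbf{1}$. Suppose that $\|\mathbf{x}-\mathbf{y}\|_\mathbf{x}\leq r_1 < 1/2$ and choose any large enough integer denominator $N$ to satisfy \[ \|H(\mathbf{x})^{1/2}\| \leq \frac{2N}{\sqrt{U}}\left( \frac{r_2-r_1}{1 + r_2}\right). \] Then every $\mathbf{x}_N \in \frac{1}{N}\mathbb{Z}^U$ with $\|\mathbf{x}_N-\mathbf{x}\|\leq \frac{\sqrt{U}}{2N}$ satisfies $\|\mathbf{x}_N - \mathbf{y}\|_{\mathbf{x}_N} \leq r_2$. In particular, taking $r_1 = r$ and $r_2 = 1/2$, we may round the certificate $\mathbf{x}$ returned by the iterative lower-bound algorithm (which returns a lower bound $c$ and a dual vector $\mathbf{x}$ satisfying $\|\mathbf{x}-\mathbf{y}\|_\mathbf{x}\leq r$, where $r\in(0,1/4]$ is the algorithm's radius parameter and $\mathbf{y}$ is the gradient certificate of $\mathbf{t}-c\mathbf{1}$) componentwise to the nearest rational vector with denominator $N$, and the resulting vector $\mathbf{x}_N$ is a rational certificate for the lower bound $c$ returned by the algorithm, i.e. $\mathbf{x}_N$ is a dual certificate of $\mathbf{t}-c\mathbf{1}$.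
   Context: $\Sigma=\Sigma^{\mathbf{g}}_{n,2\mathbf{d}}$ is a WSOS cone (polynomials $\sum_i g_i\sigma_i$ with $\sigma_i$ SOS of degree $2d_i$) with nonempty interior, identified with $\mathbb{R}^U$ via coefficient vectors in a fixed basis, $U=\dim$ of the polynomial space; $\mathbf{1}$ is the coefficient vector of the constant one polynomial, assumed in the interior of $\Sigma$; $\mathbf{t}$ is the polynomial being bounded below. $\Lambda:\mathbb{R}^U\to\mathbb{S}^{L_1}\oplus\cdots\oplus\mathbb{S}^{L_m}$ is the linear map with $\Sigma^*=\{\mathbf{x}:\Lambda(\mathbf{x})\succcurlyeq 0\}$, and $(\Sigma^* )^\circ=\{\mathbf{x}:\Lambda(\mathbf{x})\succ0\}$. The barrier is $f(\mathbf{x})=-\ln\det\Lambda(\mathbf{x})$ on $(\Sigma^* )^\circ$ with gradient $g$ and Hessian $H$; the local norm is $\|\mathbf{v}\|_\mathbf{x}=\|H(\mathbf{x})^{1/2}\mathbf{v}\|$, and $\|\cdot\|$ is the Euclidean norm (for $H(\mathbf{x})^{1/2}$, the induced operator norm). A vector $\mathbf{x}\in(\Sigma^* )^\circ$ is a dual certificate of $\mathbf{s}\in\Sigma$ if $H(\mathbf{x})^{-1}\mathbf{s}\in\Sigma^*$; the gradient certificate of $\mathbf{s}$ in the interior of $\Sigma$ is the unique $\mathbf{y}$ with $-g(\mathbf{y})=\mathbf{s}$. It is known that if $\|\mathbf{x}-\mathbf{y}\|_\mathbf{x}<1/2$ with $\mathbf{y}$ the gradient certificate of $\mathbf{s}$,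 then $\mathbf{x}$ is a dual certificate of $\mathbf{s}$. *)

theory Defs
  imports "HOL-Analysis.Analysis"
begin

definition psd :: "real^'n^'n \<Rightarrow> bool" where
  "psd A \<longleftrightarrow> transpose A = A \<and> (\<forall>v. 0 \<le> v \<bullet> (A *v v))"

definition pd :: "real^'n^'n \<Rightarrow> bool" where
  "pd A \<longleftrightarrow> transpose A = A \<and> (\<forall>v. v \<noteq> 0 \<longrightarrow> 0 < v \<bullet> (A *v v))"

definition msqrt :: "real^'n^'n \<Rightarrow> real^'n^'n" where
  "msqrt A = (THE B. psd B \<and> B ** B = A)"

definition dual_cone :: "(real^'u \<Rightarrow> real^'l^'l) \<Rightarrow> (real^'u) set" where
  "dual_cone \<Lambda> = {x. psd (\<Lambda> x)}"

definition dual_cone_int :: "(real^'u \<Rightarrow> real^'l^'l) \<Rightarrow> (real^'u) set" where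
  "dual_cone_int \<Lambda> = {x. pd (\<Lambda> x)}"

definition primal_cone :: "(real^'u \<Rightarrow> real^'l^'l) \<Rightarrow> (real^'u) set" where
  "primal_cone \<Lambda> = {s. \<forall>x \<in> dual_cone \<Lambda>. 0 \<le> s \<bullet> x}"

definition barrier :: "(real^'u \<Rightarrow> real^'l^'l) \<Rightarrow> real^'u \<Rightarrow> real" where
  "barrier \<Lambda> x = - ln (det (\<Lambda> x))"

definition grad :: "(real^'u \<Rightarrow> real^'l^'l) \<Rightarrow> real^'u \<Rightarrow> real^'u" where
  "grad \<Lambda> x = (\<chi> u. deriv (\<lambda>t. barrier \<Lambda> (x + t *\<^sub>R axis u 1)) 0)"

definition hess :: "(real^'u \<Rightarrow> real^'l^'l) \<Rightarrow> real^'u \<Rightarrow> real^'u^'u" where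
  "hess \<Lambda> x = (\<chi> u v. deriv (\<lambda>t. grad \<Lambda> (x + t *\<^sub>R axis v 1) $ u) 0)"

definition local_norm :: "(real^'u \<Rightarrow> real^'l^'l) \<Rightarrow> real^'u \<Rightarrow> real^'u \<Rightarrow> real" where
  "local_norm \<Lambda> x v = norm (msqrt (hess \<Lambda> x) *v v)"

end

theory Submission
  imports Defs
begin

text \<open>
  If T^T Lambda(x) T = I, the Hessian of the barrier -ln det Lambda at x has the quadratic form
  w |-> |T^T Lambda(w) T|^2, where the norm on real^'l^'l is the Frobenius norm; so local norms
  are norms of whitened matrices. Choosing T to diagonalize Lambda(v) as well gives
  T^T Lambda(v) T = diag e with every |e_i| <= |v|_x, and T^T Lambda(x + v) T = diag (1 + e).
  Hence, for s = |v|_x < 1, the point x + v stays in the interior of the dual cone and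
  |w|_(x+v) <= |w|_x / (1 - s) (the Dikin ellipsoid). For the rounded point,
  s = |xN - x|_x <= |H(x)^(1/2)| |xN - x| <= (r2 - r1) / (1 + r2), and then
  |xN - y|_xN <= (s + |x - y|_x) / (1 - s) <= (s + r1) / (1 - s) <= r2.
\<close>

lemma symmetric_matrix_inner:
  fixes A :: "real^'n^'n"
  assumes "transpose A = A"
  shows "(A *v x) \<bullet> y = x \<bullet> (A *v y)"
  by (metis assms dot_lmul_matrix vector_transpose_matrix)

lemma matrix_vector_mult_axis_nth: "(M *v axis i 1) $ j = M $ j $ i"
  for M :: "'a::semiring_1^'n^'m"
  by (simp add: matrix_vector_mult_def axis_def if_distrib[of "\<lambda>x. _ * x"] cong: if_cong)

lemma matrix_add_rdistrib: "(A + B) ** C = A ** C + B ** C"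
  for A B :: "'a::semiring_1^'n^'m"
  by (simp add: matrix_matrix_mult_def vec_eq_iff sum.distrib[symmetric] algebra_simps)

lemma trace_mult_symmetric:
  fixes X Y :: "real^'n^'n"
  assumes "transpose Y = Y"
  shows "trace (X ** Y) = X \<bullet> Y"
proof -
  have "Y $ j $ i = Y $ i $ j" for i j using assms by (metis transpose_def vec_lambda_beta)
  then show ?thesis by (simp add: trace_def matrix_matrix_mult_def inner_vec_def mult.commute)
qed

lemma quadratic_form_congruence:
  fixes T M :: "real^'n^'n"
  shows "x \<bullet> ((transpose T ** M ** T) *v x) = (T *v x) \<bullet> (M *v (T *v x))"
  by (metis dot_lmul_matrix matrix_vector_mul_assoc vector_transpose_matrix)

lemma linear_congruence: "linear (\<lambda>X. transpose T ** X ** T)"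
  for T :: "real^'n^'n"
  by (rule linearI) (simp_all add: matrix_add_ldistrib matrix_add_rdistrib matrix_scalar_ac scalar_matrix_assoc)

lemma congruence_add_scaleR:
  fixes T A V :: "real^'n^'n"
  shows "transpose T ** (A + t *\<^sub>R V) ** T = transpose T ** A ** T + t *\<^sub>R (transpose T ** V ** T)"
  by (simp add: matrix_add_ldistrib matrix_add_rdistrib matrix_scalar_ac scalar_matrix_assoc)

lemma linear_axis_expansion:
  fixes f :: "real^'u \<Rightarrow> 'b::real_vector"
  assumes "linear f"
  shows "f w = (\<Sum>u\<in>UNIV. w $ u *\<^sub>R f (axis u 1))"
proof -
  have "f w = f (\<Sum>u\<in>UNIV. w $ u *\<^sub>R axis u 1)"
    using basis_expansion[of w] by (simp add: scalar_mult_eq_scaleR)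
  then show ?thesis using assms by (simp add: linear_sum linear_scale)
qed

lemma matrix_inv_unique:
  fixes A B :: "real^'n^'n"
  assumes "A ** B = mat 1"
  shows "matrix_inv A = B"
proof -
  have BA: "B ** A = mat 1" using assms matrix_left_right_inverse by blast
  have "A ** matrix_inv A = mat 1 \<and> matrix_inv A ** A = mat 1"
    unfolding matrix_inv_def by (rule someI[of _ B]) (use assms BA in blast)
  then have "matrix_inv A ** (A ** B) = B" by (metis matrix_mul_assoc matrix_mul_lid)
  then show ?thesis using assms by simp
qed

definition diag_mat :: "'a::zero^'n \<Rightarrow> 'a^'n^'n" where
  "diag_mat d = (\<chi> i j. if i = j then d $ i else 0)"

lemma diag_mat_mult: "diag_mat a ** diag_mat b = diag_mat (\<chi> i. a $ i * b $ i)"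
  for a b :: "'a::semiring_1^'n"
  by (simp add: vec_eq_iff diag_mat_def matrix_matrix_mult_def if_distrib[of "\<lambda>x. x * _"] cong: if_cong)

lemma transpose_diag_mat [simp]: "transpose (diag_mat d) = diag_mat d"
  by (simp add: vec_eq_iff diag_mat_def transpose_def)

lemma diag_mat_1: "diag_mat (\<chi> i. 1) = mat 1"
  by (simp add: vec_eq_iff diag_mat_def mat_def)

lemma mat_1_add_scaleR_diag_mat: "mat 1 + t *\<^sub>R diag_mat e = diag_mat (\<chi> i. 1 + t * e $ i)"
  by (simp add: vec_eq_iff diag_mat_def mat_def)

lemma diag_mat_mult_vector: "diag_mat d *v x = (\<chi> i. d $ i * x $ i)"
  for d x :: "'a::semiring_1^'n"
  by (simp add: vec_eq_iff diag_mat_def matrix_vector_mult_def if_distrib[of "\<lambda>x. x * _"] cong: if_cong)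

lemma diag_mat_sandwich_nth: "(diag_mat a ** M ** diag_mat b) $ i $ j = a $ i * M $ i $ j * b $ j"
  for a b :: "'a::semiring_1^'n"
  by (simp add: matrix_matrix_mult_def diag_mat_def if_distrib[of "\<lambda>x. x * _"]
      if_distrib[of "\<lambda>x. _ * x"] cong: if_cong)

lemma det_diag_mat: "det (diag_mat d) = (\<Prod>i\<in>UNIV. d $ i)"
  by (subst det_diagonal) (auto simp: diag_mat_def)

lemma trace_diag_mat_mult: "trace (diag_mat d ** M) = (\<Sum>i\<in>UNIV. d $ i * M $ i $ i)"
  for d :: "'a::semiring_1^'n"
  by (simp add: trace_def matrix_matrix_mult_def diag_mat_def if_distrib[of "\<lambda>x. x * _"] cong: if_cong)

lemma norm_diag_mat: "norm (diag_mat d) = norm d"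
  for d :: "real^'n"
proof -
  have "norm (diag_mat d $ i) = \<bar>d $ i\<bar>" for i
  proof -
    have "diag_mat d $ i = d $ i *\<^sub>R axis i 1"
      by (simp add: diag_mat_def axis_def vec_eq_iff)
    then show ?thesis by simp
  qed
  then show ?thesis by (simp add: norm_vec_def)
qed

lemma norm_diag_mat_sandwich_le:
  fixes g :: "real^'n" and M :: "real^'n^'n"
  assumes g: "\<And>i. \<bar>g $ i\<bar> \<le> b"
  shows "norm (diag_mat g ** M ** diag_mat g) \<le> b\<^sup>2 * norm M"
proof -
  have "\<bar>g $ i * M $ i $ j * g $ j\<bar> \<le> \<bar>b\<^sup>2 * M $ i $ j\<bar>" for i j
  proof -
    have "0 \<le> b" using g[of i] by linarith
    then have "\<bar>g $ i\<bar> * \<bar>M $ i $ j\<bar> * \<bar>g $ j\<bar> \<le> b * \<bar>M $ i $ j\<bar> * b"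
      using g by (intro mult_mono) auto
    then show ?thesis using \<open>0 \<le> b\<close> by (simp add: abs_mult power2_eq_square mult_ac)
  qed
  then have "norm (diag_mat g ** M ** diag_mat g) \<le> norm (b\<^sup>2 *\<^sub>R M)"
    by (intro norm_le_componentwise_cart) (simp add: diag_mat_sandwich_nth)
  then show ?thesis by simp
qed

section \<open>Spectral theorem for symmetric matrices\<close>

lemma linear_le_quadratic_imp_zero:
  fixes a k :: real
  assumes "\<And>t. 2 * t * a \<le> t\<^sup>2 * k"
  shows "a = 0"
proof (rule ccontr)
  assume "a \<noteq> 0"
  define c where "c = \<bar>k\<bar> + 1"
  have c: "c > 0" "k < c" by (auto simp: c_def)
  have "2 * (a / c) * a * c\<^sup>2 \<le> (a / c)\<^sup>2 * k * c\<^sup>2"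
    using assms[of "a / c"] by (intro mult_right_mono) auto
  then have "a\<^sup>2 * (2 * c) \<le> a\<^sup>2 * k"
    using c by (simp add: power2_eq_square field_simps)
  then have "2 * c \<le> k" using \<open>a \<noteq> 0\<close> by simp
  then show False using c by linarith
qed

lemma symmetric_rayleigh_maximizer_eigenvector:
  fixes A :: "real^'n^'n"
  assumes sym: "transpose A = A" and S: "subspace S" and inv: "\<And>x. x \<in> S \<Longrightarrow> A *v x \<in> S"
    and u: "u \<in> S" "norm u = 1"
    and max: "\<And>y. y \<in> S \<Longrightarrow> y \<bullet> (A *v y) \<le> (u \<bullet> (A *v u)) * (y \<bullet> y)"
  shows "A *v u = (u \<bullet> (A *v u)) *\<^sub>R u"
proof -
  define l where "l = u \<bullet> (A *v u)"
  have uu: "u \<bullet> u = 1" using u by (simp add: norm_eq_1)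
  have orth: "w \<bullet> (A *v u) = 0" if w: "w \<in> S" "w \<bullet> u = 0" for w
  proof (rule linear_le_quadratic_imp_zero)
    fix t :: real
    have "u + t *\<^sub>R w \<in> S" using S u w by (simp add: subspace_add subspace_scale)
    from max[OF this] have
      "l + 2 * t * (w \<bullet> (A *v u)) + t\<^sup>2 * (w \<bullet> (A *v w)) \<le> l * (1 + t\<^sup>2 * (w \<bullet> w))"
      using symmetric_matrix_inner[OF sym, of w u] uu w(2)
      by (simp add: matrix_vector_right_distrib matrix_vector_mult_scaleR inner_add_left
          inner_add_right l_def power2_eq_square algebra_simps inner_commute)
    then show "2 * t * (w \<bullet> (A *v u)) \<le> t\<^sup>2 * (l * (w \<bullet> w) - w \<bullet> (A *v w))"
      by (simp add: algebra_simps)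
  qed
  define w where "w = A *v u - l *\<^sub>R u"
  have "w \<in> S" unfolding w_def using S inv u by (simp add: subspace_diff subspace_scale)
  moreover have wu: "w \<bullet> u = 0"
    unfolding w_def l_def using uu by (simp add: inner_diff_left inner_commute[of "A *v u" u])
  ultimately have "w \<bullet> (A *v u) = 0" by (rule orth)
  then have "w \<bullet> w = 0" using wu by (simp add: w_def inner_diff_right)
  then show ?thesis by (simp add: w_def l_def)
qed

lemma symmetric_eigenvector_in_invariant_subspace:
  fixes A :: "real^'n^'n"
  assumes sym: "transpose A = A" and S: "subspace S" and inv: "\<And>x. x \<in> S \<Longrightarrow> A *v x \<in> S"
    and nontrivial: "S \<noteq> {0}"
  obtains u \<mu> where "u \<in> S" "norm u = 1" "A *v u = \<mu> *\<^sub>R u"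
proof -
  define K where "K = S \<inter> sphere 0 1"
  have normalize: "y /\<^sub>R norm y \<in> K" if "y \<in> S" "y \<noteq> 0" for y
    using that S by (auto simp: K_def subspace_scale)
  have "compact K"
    unfolding K_def using closed_subspace[OF S] by (metis Int_commute compact_Int_closed compact_sphere)
  moreover have "K \<noteq> {}" using nontrivial S subspace_0 normalize by blast
  moreover have "continuous_on K (\<lambda>x. x \<bullet> (A *v x))"
    by (intro continuous_intros linear_continuous_on) auto
  ultimately obtain u where "u \<in> K" and umax: "\<And>y. y \<in> K \<Longrightarrow> y \<bullet> (A *v y) \<le> u \<bullet> (A *v u)"
    using continuous_attains_sup[of K "\<lambda>x. x \<bullet> (A *v x)"] by auto
  then have u: "u \<in> S" "norm u = 1" by (auto simp: K_def)
  have "y \<bullet> (A *v y) \<le> (u \<bullet> (A *v u)) * (y \<bullet> y)" if "y \<in> S" for y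
  proof (cases "y = 0")
    case False
    from umax[OF normalize[OF that False]]
    have "(y \<bullet> (A *v y)) / (norm y)\<^sup>2 \<le> u \<bullet> (A *v u)"
      by (simp add: matrix_vector_mult_scaleR power2_eq_square divide_simps)
    then show ?thesis using False by (simp add: divide_simps power2_norm_eq_inner)
  qed simp
  with symmetric_rayleigh_maximizer_eigenvector[OF sym S inv u] u that show ?thesis by blast
qed

lemma symmetric_orthonormal_eigenbasis:
  fixes A :: "real^'n^'n"
  assumes sym: "transpose A = A" and S: "subspace S" and inv: "\<And>x. x \<in> S \<Longrightarrow> A *v x \<in> S"
  obtains B where "B \<subseteq> S" "finite B" "pairwise orthogonal B"
    "\<And>b. b \<in> B \<Longrightarrow> norm b = 1 \<and> (\<exists>\<mu>. A *v b = \<mu> *\<^sub>R b)" "S \<subseteq> span B"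
  using S inv
proof (induction "dim S" arbitrary: S thesis rule: less_induct)
  case less
  show ?case
  proof (cases "S = {0}")
    case True
    then show ?thesis by (intro less.prems(1)[of "{}"]) auto
  next
    case False
    obtain u \<mu> where u: "u \<in> S" "norm u = 1" "A *v u = \<mu> *\<^sub>R u"
      using symmetric_eigenvector_in_invariant_subspace[OF sym less.prems(2,3) False] by blast
    define S' where "S' = S \<inter> {x. u \<bullet> x = 0}"
    have S': "subspace S'"
      unfolding S'_def using less.prems(2) subspace_hyperplane by (rule subspace_inter)
    have inv': "A *v x \<in> S'" if "x \<in> S'" for x
      using that less.prems(3) u(3) symmetric_matrix_inner[OF sym, of u x] by (simp add: S'_def)
    have "u \<notin> S'" using u(2) by (simp add: S'_def norm_eq_1)
    then have "span S' \<subset> span S"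
      using u(1) S' less.prems(2) by (metis Int_lower1 S'_def span_eq_iff psubsetI span_mono)
    then have "dim S' < dim S" by (rule dim_psubset)
    then obtain B where B: "B \<subseteq> S'" "finite B" "pairwise orthogonal B"
        "\<And>b. b \<in> B \<Longrightarrow> norm b = 1 \<and> (\<exists>\<mu>. A *v b = \<mu> *\<^sub>R b)" "S' \<subseteq> span B"
      using less.hyps S' inv' by blast
    show ?thesis
    proof (rule less.prems(1)[of "insert u B"])
      show "insert u B \<subseteq> S" "finite (insert u B)" using B(1,2) u(1) by (auto simp: S'_def)
      show "pairwise orthogonal (insert u B)"
        using B(1,3) by (auto simp: pairwise_insert S'_def orthogonal_def inner_commute)
      show "norm b = 1 \<and> (\<exists>\<mu>. A *v b = \<mu> *\<^sub>R b)" if "b \<in> insert u B" for b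
        using that B(4) u by auto
      have "x - (u \<bullet> x) *\<^sub>R u \<in> span B" if "x \<in> S" for x
        using that u less.prems(2) B(5)
        by (auto simp: S'_def subspace_diff subspace_scale inner_diff_right norm_eq_1)
      then show "S \<subseteq> span (insert u B)" by (auto simp: span_insert)
    qed
  qed
qed

lemma symmetric_spectral_decomposition:
  fixes A :: "real^'n^'n"
  assumes sym: "transpose A = A"
  obtains Q d where "orthogonal_matrix Q" "transpose Q ** A ** Q = diag_mat d"
    "A = Q ** diag_mat d ** transpose Q"
proof -
  obtain B where B: "B \<subseteq> UNIV" "finite B" "pairwise orthogonal B"
      "\<And>b. b \<in> B \<Longrightarrow> norm b = 1 \<and> (\<exists>\<mu>. A *v b = \<mu> *\<^sub>R b)" "UNIV \<subseteq> span B"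
    using symmetric_orthonormal_eigenbasis[OF sym subspace_UNIV UNIV_I] by auto
  have "independent B" using B(3) B(4)[of 0] by (intro pairwise_orthogonal_independent) auto
  then have "card B = CARD('n)" using basis_card_eq_dim[OF _ B(5)] by simp
  then obtain e :: "'n \<Rightarrow> real^'n" where e: "bij_betw e UNIV B"
    using finite_same_card_bij[of "UNIV :: 'n set" B] B(2) by auto
  obtain \<mu> where \<mu>: "\<And>b. b \<in> B \<Longrightarrow> A *v b = \<mu> b *\<^sub>R b" using B(4) by metis
  define Q where "Q = (\<chi> i j. e j $ i)"
  define d where "d = (\<chi> i. \<mu> (e i))"
  have eB: "e i \<in> B" for i using e by (auto simp: bij_betw_def)
  have Q: "orthogonal_matrix Q"
    unfolding orthogonal_matrix_orthonormal_columns
  proof (intro conjI allI impI)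
    show "norm (column i Q) = 1" for i using B(4) eB by (simp add: column_def Q_def vec_eq_iff)
    show "orthogonal (column i Q) (column j Q)" if "i \<noteq> j" for i j
    proof -
      have "column i Q = e i" "column j Q = e j" by (simp_all add: column_def Q_def vec_eq_iff)
      moreover have "e i \<noteq> e j" using e that by (auto simp: bij_betw_def inj_def)
      ultimately show ?thesis using B(3) eB unfolding pairwise_def by simp
    qed
  qed
  have AQ: "A ** Q = Q ** diag_mat d"
  proof -
    have "(A ** Q) $ i $ j = (A *v e j) $ i" for i j
      by (simp add: matrix_matrix_mult_def matrix_vector_mult_def Q_def)
    then show ?thesis using \<mu>[OF eB]
      by (simp add: vec_eq_iff matrix_matrix_mult_def diag_mat_def Q_def d_def
          if_distrib[of "\<lambda>x. _ * x"] cong: if_cong)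
  qed
  have "transpose Q ** Q = mat 1" "Q ** transpose Q = mat 1"
    using Q by (auto simp: orthogonal_matrix_def)
  then show ?thesis
    using that[OF Q] AQ by (metis matrix_mul_assoc matrix_mul_lid matrix_mul_rid)
qed

section \<open>Congruence and simultaneous diagonalization\<close>

lemma congruence_diag_nonneg:
  fixes A T :: "real^'n^'n"
  assumes "psd A" "transpose T ** A ** T = diag_mat d"
  shows "0 \<le> d $ i"
  using quadratic_form_congruence[of "axis i 1" T A] assms
  by (simp add: psd_def diag_mat_mult_vector inner_axis')

lemma congruence_diag_pos:
  fixes A T :: "real^'n^'n"
  assumes "pd A" "invertible T" "transpose T ** A ** T = diag_mat d"
  shows "0 < d $ i"
proof -
  obtain T' where "T' ** T = mat 1" using assms(2) by (auto simp: invertible_def)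
  then have "T' *v (T *v axis i 1) = axis i 1" by (simp add: matrix_vector_mul_assoc)
  then have "T *v axis i 1 \<noteq> 0" by (auto simp: axis_eq_0_iff)
  then show ?thesis
    using quadratic_form_congruence[of "axis i 1" T A] assms(1,3)
    by (simp add: pd_def diag_mat_mult_vector inner_axis')
qed

lemma congruent_mat_1_matrix_inv:
  fixes A T :: "real^'n^'n"
  assumes "transpose T ** A ** T = mat 1"
  shows "matrix_inv A = T ** transpose T" "invertible T"
proof -
  have TA: "T ** (transpose T ** A) = mat 1"
    using assms matrix_left_right_inverse by (metis matrix_mul_assoc)
  then have "A ** (T ** transpose T) = mat 1"
    using matrix_left_right_inverse by (metis matrix_mul_assoc)
  then show "matrix_inv A = T ** transpose T" by (rule matrix_inv_unique)
  show "invertible T" using TA matrix_left_right_inverse invertible_def by blast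
qed

lemma matrix_inv_congruent_diag:
  fixes M T :: "real^'n^'n"
  assumes D: "transpose T ** M ** T = diag_mat d" and nz: "\<And>i. d $ i \<noteq> 0"
  shows "matrix_inv M = T ** diag_mat (\<chi> i. 1 / d $ i) ** transpose T"
proof -
  have "diag_mat d ** diag_mat (\<chi> i. 1 / d $ i) = mat 1"
    using nz by (simp add: diag_mat_mult diag_mat_1[symmetric] vec_eq_iff)
  then have "(transpose T ** M) ** (T ** diag_mat (\<chi> i. 1 / d $ i)) = mat 1"
    using D by (simp add: matrix_mul_assoc)
  then have "M ** (T ** diag_mat (\<chi> i. 1 / d $ i) ** transpose T) = mat 1"
    using matrix_left_right_inverse by (metis matrix_mul_assoc)
  then show ?thesis by (rule matrix_inv_unique)
qed

lemma pd_if_congruent_diag_pos: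
  fixes M T :: "real^'n^'n"
  assumes T: "invertible T" and sym: "transpose M = M" and D: "transpose T ** M ** T = diag_mat d"
    and pos: "\<And>i. 0 < d $ i"
  shows "pd M"
  unfolding pd_def
proof (intro conjI allI impI sym)
  fix x :: "real^'n"
  assume "x \<noteq> 0"
  obtain T' where "T ** T' = mat 1" using T by (auto simp: invertible_def)
  then obtain y where y: "T *v y = x" by (metis matrix_vector_mul_assoc matrix_vector_mul_lid)
  with \<open>x \<noteq> 0\<close> have "y \<noteq> 0" by auto
  then obtain i where i: "y $ i \<noteq> 0" by (auto simp: vec_eq_iff)
  have "x \<bullet> (M *v x) = (\<Sum>j\<in>UNIV. d $ j * (y $ j)\<^sup>2)"
    using quadratic_form_congruence[of y T M] D y
    by (simp add: diag_mat_mult_vector inner_vec_def power2_eq_square algebra_simps)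
  also have "\<dots> \<ge> d $ i * (y $ i)\<^sup>2"
    by (rule member_le_sum) (auto intro: mult_nonneg_nonneg less_imp_le[OF pos])
  finally show "0 < x \<bullet> (M *v x)"
    using pos[of i] i by (meson less_le_trans mult_pos_pos zero_less_power2)
qed

lemma pd_congruent_mat_1:
  fixes A :: "real^'n^'n"
  assumes "pd A"
  obtains P :: "real^'n^'n" where "transpose P ** A ** P = mat 1"
proof -
  obtain Q d where Q: "orthogonal_matrix Q" "transpose Q ** A ** Q = diag_mat d"
    using assms symmetric_spectral_decomposition by (metis pd_def)
  have "invertible Q" using Q(1) by (auto simp: orthogonal_matrix_def invertible_def)
  then have d: "0 < d $ i" for i using congruence_diag_pos assms Q(2) by blast
  define s where "s = (\<chi> i. 1 / sqrt (d $ i))"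
  have "transpose (Q ** diag_mat s) ** A ** (Q ** diag_mat s)
      = diag_mat s ** (transpose Q ** A ** Q) ** diag_mat s"
    by (simp add: matrix_transpose_mul matrix_mul_assoc)
  also have "\<dots> = diag_mat s ** diag_mat d ** diag_mat s" by (simp only: Q(2))
  also have "\<dots> = mat 1"
    using d d[THEN less_imp_neq] by (simp add: diag_mat_mult s_def diag_mat_1[symmetric] vec_eq_iff abs_of_pos)
  finally show ?thesis by (rule that)
qed

lemma pd_simultaneous_diagonalization:
  fixes A V :: "real^'n^'n"
  assumes "pd A" "transpose V = V"
  obtains T :: "real^'n^'n" and e where "transpose T ** A ** T = mat 1" "transpose T ** V ** T = diag_mat e"
proof -
  obtain P :: "real^'n^'n" where P: "transpose P ** A ** P = mat 1" using pd_congruent_mat_1[OF assms(1)] .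
  have "transpose (transpose P ** V ** P) = transpose P ** V ** P"
    using assms(2) by (simp add: matrix_transpose_mul matrix_mul_assoc)
  then obtain R :: "real^'n^'n" and e where R: "orthogonal_matrix R" "transpose R ** (transpose P ** V ** P) ** R = diag_mat e"
    using symmetric_spectral_decomposition by blast
  have "transpose (P ** R) ** A ** (P ** R) = transpose R ** (transpose P ** A ** P) ** R"
       "transpose (P ** R) ** V ** (P ** R) = transpose R ** (transpose P ** V ** P) ** R"
    by (simp_all add: matrix_transpose_mul matrix_mul_assoc)
  with P R that[of "P ** R" e] show ?thesis by (simp add: orthogonal_matrix_def)
qed

lemma congruent_line_diag_mat:
  fixes T A V :: "real^'n^'n"
  assumes "transpose T ** A ** T = mat 1" "transpose T ** V ** T = diag_mat e"
  shows "transpose T ** (A + t *\<^sub>R V) ** T = diag_mat (\<chi> i. 1 + t * e $ i)"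
  using assms by (simp add: congruence_add_scaleR mat_1_add_scaleR_diag_mat)

section \<open>The positive semidefinite square root\<close>

lemma psd_sqrt_eigenvector:
  fixes B :: "real^'n^'n"
  assumes B: "psd B" and c: "0 \<le> c" and q: "(B ** B) *v q = c\<^sup>2 *\<^sub>R q"
  shows "B *v q = c *\<^sub>R q"
proof -
  have sym: "transpose B = B" using B by (simp add: psd_def)
  define w where "w = B *v q - c *\<^sub>R q"
  have "B *v w + c *\<^sub>R w = (B ** B) *v q - c\<^sup>2 *\<^sub>R q"
    by (simp add: w_def matrix_vector_mult_diff_distrib matrix_vector_mult_scaleR
        matrix_vector_mul_assoc[symmetric] algebra_simps power2_eq_square)
  then have Bw: "B *v w = - c *\<^sub>R w" using q by (simp add: eq_neg_iff_add_eq_0)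
  have "0 \<le> w \<bullet> (B *v w)" using B by (simp add: psd_def)
  then have "c * (w \<bullet> w) \<le> 0" using Bw by simp
  then have "c * (w \<bullet> w) = 0" using c by (meson antisym inner_ge_zero mult_nonneg_nonneg)
  moreover have "w \<bullet> w = q \<bullet> (B *v w)" if "c = 0"
    using that by (simp add: w_def symmetric_matrix_inner[OF sym, symmetric])
  ultimately have "w = 0" using Bw by (cases "c = 0") auto
  then show ?thesis by (simp add: w_def)
qed

lemma psd_sqrt_unique:
  fixes B C :: "real^'n^'n"
  assumes B: "psd B" and C: "psd C" and BC: "B ** B = C ** C"
  shows "B = C"
proof -
  define H where "H = B ** B"
  have symB: "transpose B = B" using B by (simp add: psd_def)
  then have symH: "transpose H = H" by (simp add: H_def matrix_transpose_mul)
  then obtain Q h where Q: "orthogonal_matrix Q" "transpose Q ** H ** Q = diag_mat h"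
      "H = Q ** diag_mat h ** transpose Q"
    by (rule symmetric_spectral_decomposition)
  have QQ: "transpose Q ** Q = mat 1" "Q ** transpose Q = mat 1"
    using Q(1) by (auto simp: orthogonal_matrix_def)
  have "v \<bullet> (H *v v) = (B *v v) \<bullet> (B *v v)" for v
    using symmetric_matrix_inner[OF symB, of v "B *v v"] by (simp add: H_def matrix_vector_mul_assoc)
  then have "psd H" using symH by (simp add: psd_def)
  then have h: "0 \<le> h $ i" for i using congruence_diag_nonneg Q(2) by blast
  have HQ: "H ** Q = Q ** diag_mat h" using Q(3) QQ(1) by (metis matrix_mul_assoc matrix_mul_rid)
  have "diag_mat h *v axis i 1 = h $ i *\<^sub>R axis i 1" for i
    by (simp add: diag_mat_mult_vector axis_def vec_eq_iff)
  then have "H *v (Q *v axis i 1) = h $ i *\<^sub>R (Q *v axis i 1)" for i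
    by (metis HQ matrix_vector_mul_assoc matrix_vector_mult_scaleR)
  then have "H *v (Q *v axis i 1) = (sqrt (h $ i))\<^sup>2 *\<^sub>R (Q *v axis i 1)" for i
    using h by simp
  then have "B *v (Q *v axis i 1) = C *v (Q *v axis i 1)" for i
    using psd_sqrt_eigenvector[OF B, of "sqrt (h $ i)"] psd_sqrt_eigenvector[OF C, of "sqrt (h $ i)"]
      BC h[of i] by (simp add: H_def)
  then have "B ** Q = C ** Q"
    by (simp add: vec_eq_iff matrix_vector_mul_assoc matrix_vector_mult_axis_nth[symmetric])
  then show ?thesis using QQ(2) by (metis matrix_mul_assoc matrix_mul_rid)
qed

lemma psd_sqrt_exists:
  fixes H :: "real^'n^'n"
  assumes H: "psd H"
  obtains R where "psd R" "R ** R = H"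
proof -
  obtain Q h where Q: "orthogonal_matrix Q" "transpose Q ** H ** Q = diag_mat h"
      "H = Q ** diag_mat h ** transpose Q"
    using H symmetric_spectral_decomposition by (metis psd_def)
  have QQ: "transpose Q ** Q = mat 1" using Q(1) by (simp add: orthogonal_matrix_def)
  have h: "0 \<le> h $ i" for i using congruence_diag_nonneg[OF H Q(2)] .
  define R where "R = Q ** diag_mat (\<chi> i. sqrt (h $ i)) ** transpose Q"
  have "R ** R = Q ** (diag_mat (\<chi> i. sqrt (h $ i)) ** (transpose Q ** Q) ** diag_mat (\<chi> i. sqrt (h $ i))) ** transpose Q"
    by (simp add: R_def matrix_mul_assoc)
  also have "diag_mat (\<chi> i. sqrt (h $ i)) ** (transpose Q ** Q) ** diag_mat (\<chi> i. sqrt (h $ i)) = diag_mat h"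
    using h by (simp add: QQ diag_mat_mult vec_eq_iff)
  finally have "R ** R = H" using Q(3) by simp
  moreover have "psd R"
    unfolding psd_def
  proof (intro conjI allI)
    show "transpose R = R" by (simp add: R_def matrix_transpose_mul matrix_mul_assoc)
    fix v
    have "v \<bullet> (R *v v) = (\<Sum>i\<in>UNIV. sqrt (h $ i) * ((transpose Q *v v) $ i)\<^sup>2)"
      using quadratic_form_congruence[of v "transpose Q" "diag_mat (\<chi> i. sqrt (h $ i))"]
      by (simp add: R_def diag_mat_mult_vector inner_vec_def power2_eq_square algebra_simps)
    also have "\<dots> \<ge> 0" using h by (intro sum_nonneg mult_nonneg_nonneg) auto
    finally show "0 \<le> v \<bullet> (R *v v)" .
  qed
  ultimately show ?thesis using that by blast
qed

lemma msqrt_eq: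
  fixes B H :: "real^'n^'n"
  assumes "psd B" "B ** B = H"
  shows "msqrt H = B"
  unfolding msqrt_def
proof (rule the_equality)
  show "psd B \<and> B ** B = H" using assms by simp
  show "C = B" if "psd C \<and> C ** C = H" for C
    using that assms psd_sqrt_unique[of C B] by simp
qed

lemma msqrt_psd_sqrt:
  fixes H :: "real^'n^'n"
  assumes "psd H"
  shows "psd (msqrt H)" "msqrt H ** msqrt H = H"
proof -
  obtain R where R: "psd R" "R ** R = H" using psd_sqrt_exists[OF assms] .
  then have "msqrt H = R" by (rule msqrt_eq)
  with R show "psd (msqrt H)" "msqrt H ** msqrt H = H" by simp_all
qed

lemma norm_msqrt_mult_vector_square:
  fixes H :: "real^'n^'n"
  assumes "psd H"
  shows "(norm (msqrt H *v v))\<^sup>2 = v \<bullet> (H *v v)"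
proof -
  have "transpose (msqrt H) = msqrt H" using msqrt_psd_sqrt(1)[OF assms] by (simp add: psd_def)
  then have "(msqrt H *v v) \<bullet> (msqrt H *v v) = v \<bullet> (msqrt H *v (msqrt H *v v))"
    by (rule symmetric_matrix_inner)
  then show ?thesis
    using msqrt_psd_sqrt(2)[OF assms] by (simp add: power2_norm_eq_inner matrix_vector_mul_assoc)
qed

section \<open>Derivatives along a line of positive definite matrices\<close>

lemma eventually_one_add_mult_pos: "\<forall>\<^sub>F t in nhds 0. \<forall>i. 0 < 1 + t * e $ i"
  for e :: "real^'n"
proof (intro eventually_all_finite allI)
  fix i
  have "((\<lambda>t. 1 + t * e $ i) \<longlongrightarrow> 1 + 0 * e $ i) (nhds 0)"
    by (intro tendsto_intros filterlim_ident)
  then show "\<forall>\<^sub>F t in nhds 0. 0 < 1 + t * e $ i" by (rule order_tendstoD) simp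
qed

lemma eventually_pd_line:
  fixes A V :: "real^'n^'n"
  assumes A: "pd A" and V: "transpose V = V"
  shows "\<forall>\<^sub>F t in nhds 0. pd (A + t *\<^sub>R V)"
proof -
  obtain T :: "real^'n^'n" and e where T: "transpose T ** A ** T = mat 1" "transpose T ** V ** T = diag_mat e"
    using pd_simultaneous_diagonalization[OF A V] .
  have invT: "invertible T" using congruent_mat_1_matrix_inv(2)[OF T(1)] .
  have "pd (A + t *\<^sub>R V)" if "\<forall>i. 0 < 1 + t * e $ i" for t
  proof (rule pd_if_congruent_diag_pos[OF invT _ congruent_line_diag_mat[OF T]])
    show "transpose (A + t *\<^sub>R V) = A + t *\<^sub>R V"
      using A V by (simp add: pd_def transpose_def vec_eq_iff)
  qed (use that in simp)
  then show ?thesis by (rule eventually_mono[OF eventually_one_add_mult_pos])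
qed

lemma ln_det_line_has_derivative:
  fixes A V :: "real^'n^'n"
  assumes A: "pd A" and V: "transpose V = V"
  shows "((\<lambda>t. ln (det (A + t *\<^sub>R V))) has_real_derivative trace (matrix_inv A ** V)) (at 0)"
proof -
  obtain T :: "real^'n^'n" and e where T: "transpose T ** A ** T = mat 1" "transpose T ** V ** T = diag_mat e"
    using pd_simultaneous_diagonalization[OF A V] .
  have inv: "matrix_inv A = T ** transpose T" "invertible T"
    using congruent_mat_1_matrix_inv[OF T(1)] by auto
  define c where "c = (det T)\<^sup>2"
  have c: "0 < c" using inv(2) by (simp add: c_def invertible_det_nz)
  define p where "p t = (\<Prod>i\<in>UNIV. 1 + t * e $ i)" for t
  have "c * det (A + t *\<^sub>R V) = p t" for t
  proof -
    have "c * det (A + t *\<^sub>R V) = det (transpose T ** (A + t *\<^sub>R V) ** T)"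
      by (simp add: c_def det_mul det_transpose power2_eq_square)
    also have "\<dots> = p t" by (simp add: congruent_line_diag_mat[OF T] det_diag_mat p_def)
    finally show ?thesis .
  qed
  then have det: "det (A + t *\<^sub>R V) = p t / c" for t using c by (simp add: field_simps)
  have "(p has_real_derivative (\<Sum>i\<in>UNIV. e $ i * (\<Prod>j\<in>UNIV - {i}. 1 + 0 * e $ j))) (at 0)"
    unfolding p_def by (rule has_field_derivative_prod) (auto intro!: derivative_eq_intros)
  then have dp: "(p has_real_derivative (\<Sum>i\<in>UNIV. e $ i)) (at 0)" by simp
  have "p 0 = 1" by (simp add: p_def)
  then have "((\<lambda>t. ln (p t / c)) has_real_derivative (\<Sum>i\<in>UNIV. e $ i) / c / (p 0 / c)) (at 0)"
    using c by (auto intro!: derivative_eq_intros dp)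
  then have "((\<lambda>t. ln (p t / c)) has_real_derivative (\<Sum>i\<in>UNIV. e $ i)) (at 0)"
    using c \<open>p 0 = 1\<close> by simp
  moreover have "(\<Sum>i\<in>UNIV. e $ i) = trace (matrix_inv A ** V)"
  proof -
    have "(\<Sum>i\<in>UNIV. e $ i) = trace ((transpose T ** V) ** T)"
      using T(2) by (simp add: trace_def diag_mat_def)
    also have "\<dots> = trace (matrix_inv A ** V)"
      by (simp add: inv trace_mul_sym[of _ T] matrix_mul_assoc)
    finally show ?thesis .
  qed
  ultimately show ?thesis by (simp add: det)
qed

lemma trace_matrix_inv_line_has_derivative:
  fixes A V L :: "real^'n^'n"
  assumes A: "pd A" and V: "transpose V = V"
  shows "((\<lambda>t. trace (matrix_inv (A + t *\<^sub>R V) ** L)) has_real_derivative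
           - trace (V ** matrix_inv A ** L ** matrix_inv A)) (at 0)"
proof -
  obtain T :: "real^'n^'n" and e where T: "transpose T ** A ** T = mat 1" "transpose T ** V ** T = diag_mat e"
    using pd_simultaneous_diagonalization[OF A V] .
  have inv: "matrix_inv A = T ** transpose T" using congruent_mat_1_matrix_inv[OF T(1)] by auto
  define N where "N = transpose T ** L ** T"
  define \<phi> where "\<phi> t = (\<Sum>i\<in>UNIV. N $ i $ i / (1 + t * e $ i))" for t
  have "\<forall>\<^sub>F t in nhds 0. \<phi> t = trace (matrix_inv (A + t *\<^sub>R V) ** L)"
    using eventually_one_add_mult_pos[of e]
  proof eventually_elim
    case (elim t)
    then have "matrix_inv (A + t *\<^sub>R V) = T ** diag_mat (\<chi> i. 1 / (1 + t * e $ i)) ** transpose T"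
      using matrix_inv_congruent_diag[OF congruent_line_diag_mat[OF T]] by (simp add: less_imp_neq[symmetric])
    then have "trace (matrix_inv (A + t *\<^sub>R V) ** L)
        = trace (T ** (diag_mat (\<chi> i. 1 / (1 + t * e $ i)) ** transpose T ** L))"
      by (simp add: matrix_mul_assoc)
    also have "\<dots> = trace (diag_mat (\<chi> i. 1 / (1 + t * e $ i)) ** N)"
      by (subst trace_mul_sym) (simp add: N_def matrix_mul_assoc)
    finally have "trace (matrix_inv (A + t *\<^sub>R V) ** L) = trace (diag_mat (\<chi> i. 1 / (1 + t * e $ i)) ** N)" .
    then show ?case by (simp add: \<phi>_def trace_diag_mat_mult)
  qed
  moreover have "(\<phi> has_real_derivative - (\<Sum>i\<in>UNIV. e $ i * N $ i $ i)) (at 0)"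
    unfolding \<phi>_def by (auto intro!: derivative_eq_intros simp: sum_negf[symmetric] mult.commute)
  moreover have "(\<Sum>i\<in>UNIV. e $ i * N $ i $ i) = trace (V ** matrix_inv A ** L ** matrix_inv A)"
  proof -
    have "(\<Sum>i\<in>UNIV. e $ i * N $ i $ i) = trace (transpose T ** (V ** T ** transpose T ** L ** T))"
      using T(2) by (simp add: trace_diag_mat_mult[symmetric] N_def matrix_mul_assoc)
    also have "\<dots> = trace ((V ** T ** transpose T ** L ** T) ** transpose T)"
      by (rule trace_mul_sym)
    also have "\<dots> = trace (V ** matrix_inv A ** L ** matrix_inv A)"
      by (simp add: inv matrix_mul_assoc)
    finally show ?thesis .
  qed
  ultimately show ?thesis using DERIV_cong_ev by fastforce
qed

section \<open>The log-det barrier and its Dikin ellipsoid\<close>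

lemma local_norm_triangle: "local_norm \<Lambda> x (v + w) \<le> local_norm \<Lambda> x v + local_norm \<Lambda> x w"
  unfolding local_norm_def by (simp add: matrix_vector_right_distrib norm_triangle_ineq)

lemma local_norm_le_onorm: "local_norm \<Lambda> x v \<le> onorm (\<lambda>v. msqrt (hess \<Lambda> x) *v v) * norm v"
  unfolding local_norm_def by (rule onorm) simp

locale symmetric_linear_map =
  fixes \<Lambda> :: "real^'u \<Rightarrow> real^'l^'l"
  assumes linear: "linear \<Lambda>" and symmetric: "transpose (\<Lambda> z) = \<Lambda> z"
begin

lemma map_add_scaleR: "\<Lambda> (z + t *\<^sub>R v) = \<Lambda> z + t *\<^sub>R \<Lambda> v"
  using linear by (simp add: linear_add linear_scale)

lemma symmetric_congruence: "transpose (transpose T ** \<Lambda> z ** T) = transpose T ** \<Lambda> z ** T"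
  for T :: "real^'l^'l"
  by (simp add: matrix_transpose_mul matrix_mul_assoc symmetric)

lemma grad_eq:
  assumes "pd (\<Lambda> z)"
  shows "grad \<Lambda> z $ u = - trace (matrix_inv (\<Lambda> z) ** \<Lambda> (axis u 1))"
proof -
  have "((\<lambda>t. barrier \<Lambda> (z + t *\<^sub>R axis u 1)) has_real_derivative
          - trace (matrix_inv (\<Lambda> z) ** \<Lambda> (axis u 1))) (at 0)"
    using DERIV_minus[OF ln_det_line_has_derivative[OF assms symmetric]] by (simp add: barrier_def map_add_scaleR)
  then show ?thesis unfolding grad_def by (simp add: DERIV_imp_deriv)
qed

lemma hess_eq:
  assumes z: "pd (\<Lambda> z)"
  shows "hess \<Lambda> z $ u $ v
    = trace (\<Lambda> (axis v 1) ** matrix_inv (\<Lambda> z) ** \<Lambda> (axis u 1) ** matrix_inv (\<Lambda> z))"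
proof -
  let ?g = "\<lambda>t. - trace (matrix_inv (\<Lambda> z + t *\<^sub>R \<Lambda> (axis v 1)) ** \<Lambda> (axis u 1))"
  have "\<forall>\<^sub>F t in nhds 0. ?g t = grad \<Lambda> (z + t *\<^sub>R axis v 1) $ u"
    using eventually_pd_line[OF z symmetric[of "axis v 1"]] by eventually_elim (simp add: grad_eq map_add_scaleR)
  moreover have "(?g has_real_derivative
      trace (\<Lambda> (axis v 1) ** matrix_inv (\<Lambda> z) ** \<Lambda> (axis u 1) ** matrix_inv (\<Lambda> z))) (at 0)"
    using DERIV_minus[OF trace_matrix_inv_line_has_derivative[OF z symmetric]] by simp
  ultimately have "((\<lambda>t. grad \<Lambda> (z + t *\<^sub>R axis v 1) $ u) has_real_derivative
      trace (\<Lambda> (axis v 1) ** matrix_inv (\<Lambda> z) ** \<Lambda> (axis u 1) ** matrix_inv (\<Lambda> z))) (at 0)"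
    by (simp add: DERIV_cong_ev)
  then show ?thesis unfolding hess_def by (simp add: DERIV_imp_deriv)
qed

lemma hess_eq_inner:
  fixes T :: "real^'l^'l"
  assumes z: "pd (\<Lambda> z)" and T: "transpose T ** \<Lambda> z ** T = mat 1"
  shows "hess \<Lambda> z $ u $ v
    = (transpose T ** \<Lambda> (axis u 1) ** T) \<bullet> (transpose T ** \<Lambda> (axis v 1) ** T)"
proof -
  have "hess \<Lambda> z $ u $ v
      = trace ((\<Lambda> (axis v 1) ** T ** transpose T ** \<Lambda> (axis u 1) ** T) ** transpose T)"
    by (simp add: hess_eq[OF z] congruent_mat_1_matrix_inv(1)[OF T] matrix_mul_assoc)
  also have "\<dots> = trace (transpose T ** (\<Lambda> (axis v 1) ** T ** transpose T ** \<Lambda> (axis u 1) ** T))"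
    by (rule trace_mul_sym)
  also have "\<dots> = trace ((transpose T ** \<Lambda> (axis v 1) ** T) ** (transpose T ** \<Lambda> (axis u 1) ** T))"
    by (simp add: matrix_mul_assoc)
  also have "\<dots> = (transpose T ** \<Lambda> (axis u 1) ** T) \<bullet> (transpose T ** \<Lambda> (axis v 1) ** T)"
    by (simp add: trace_mult_symmetric symmetric_congruence inner_commute)
  finally show ?thesis .
qed

lemma hess_quadratic_form:
  fixes T :: "real^'l^'l"
  assumes z: "pd (\<Lambda> z)" and T: "transpose T ** \<Lambda> z ** T = mat 1"
  shows "w \<bullet> (hess \<Lambda> z *v w) = (norm (transpose T ** \<Lambda> w ** T))\<^sup>2"
proof -
  define N where "N u = transpose T ** \<Lambda> (axis u 1) ** T" for u
  have "(\<lambda>X. transpose T ** X ** T) (\<Lambda> w) = (\<Sum>u\<in>UNIV. w $ u *\<^sub>R (\<lambda>X. transpose T ** X ** T) (\<Lambda> (axis u 1)))"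
    using linear_axis_expansion[OF linear_compose[OF linear linear_congruence[of T]]]
    unfolding o_def .
  then have expansion: "transpose T ** \<Lambda> w ** T = (\<Sum>u\<in>UNIV. w $ u *\<^sub>R N u)"
    by (simp add: N_def)
  have "(hess \<Lambda> z *v w) $ u = (\<Sum>v\<in>UNIV. w $ v * (N u \<bullet> N v))" for u
    by (simp add: matrix_vector_mult_def hess_eq_inner[OF z T] N_def mult.commute)
  then have "w \<bullet> (hess \<Lambda> z *v w) = (\<Sum>u\<in>UNIV. w $ u * (\<Sum>v\<in>UNIV. w $ v * (N u \<bullet> N v)))"
    by (simp add: inner_vec_def)
  also have "\<dots> = (\<Sum>u\<in>UNIV. w $ u * (N u \<bullet> (\<Sum>v\<in>UNIV. w $ v *\<^sub>R N v)))"
    by (simp add: inner_sum_right)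
  also have "\<dots> = (\<Sum>u\<in>UNIV. w $ u *\<^sub>R N u) \<bullet> (\<Sum>v\<in>UNIV. w $ v *\<^sub>R N v)"
    by (simp add: inner_sum_left)
  finally show ?thesis by (simp add: expansion power2_norm_eq_inner)
qed

lemma hess_psd:
  assumes z: "pd (\<Lambda> z)"
  shows "psd (hess \<Lambda> z)"
proof -
  obtain T :: "real^'l^'l" where T: "transpose T ** \<Lambda> z ** T = mat 1"
    using pd_congruent_mat_1[OF z] .
  have "transpose (hess \<Lambda> z) = hess \<Lambda> z"
    by (simp add: vec_eq_iff transpose_def hess_eq_inner[OF z T] inner_commute)
  then show ?thesis by (simp add: psd_def hess_quadratic_form[OF z T])
qed

lemma local_norm_eq:
  fixes T :: "real^'l^'l"
  assumes z: "pd (\<Lambda> z)" and T: "transpose T ** \<Lambda> z ** T = mat 1"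
  shows "local_norm \<Lambda> z w = norm (transpose T ** \<Lambda> w ** T)"
  using norm_msqrt_mult_vector_square[OF hess_psd[OF z], of w] hess_quadratic_form[OF z T, of w]
  unfolding local_norm_def by (metis norm_ge_zero power2_eq_imp_eq)

lemma dikin_congruence:
  fixes v :: "real^'u"
  assumes x: "pd (\<Lambda> x)"
  obtains T :: "real^'l^'l" and e where "transpose T ** \<Lambda> x ** T = mat 1" "invertible T"
    "transpose T ** \<Lambda> (x + v) ** T = diag_mat (\<chi> i. 1 + e $ i)"
    "\<And>i. 1 - local_norm \<Lambda> x v \<le> 1 + e $ i"
proof -
  obtain T :: "real^'l^'l" and e where T: "transpose T ** \<Lambda> x ** T = mat 1" "transpose T ** \<Lambda> v ** T = diag_mat e"
    using pd_simultaneous_diagonalization[OF x symmetric] .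
  have "1 - local_norm \<Lambda> x v \<le> 1 + e $ i" for i
    using component_le_norm_cart[of e i] local_norm_eq[OF x T(1), of v] T(2)
    by (simp add: norm_diag_mat abs_le_iff)
  moreover have "transpose T ** \<Lambda> (x + v) ** T = diag_mat (\<chi> i. 1 + e $ i)"
    using congruent_line_diag_mat[OF T, of 1] by (simp add: linear_add[OF linear])
  ultimately show ?thesis using that T(1) congruent_mat_1_matrix_inv(2)[OF T(1)] by blast
qed

lemma pd_dikin_ellipsoid:
  assumes x: "pd (\<Lambda> x)" and v: "local_norm \<Lambda> x v < 1"
  shows "pd (\<Lambda> (x + v))"
proof -
  obtain T :: "real^'l^'l" and e where T: "transpose T ** \<Lambda> x ** T = mat 1" "invertible T"
      "transpose T ** \<Lambda> (x + v) ** T = diag_mat (\<chi> i. 1 + e $ i)"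
      "\<And>i. 1 - local_norm \<Lambda> x v \<le> 1 + e $ i"
    using dikin_congruence[OF x, where v = v] by blast
  have "0 < 1 + e $ i" for i using v T(4)[of i] by linarith
  then show ?thesis by (intro pd_if_congruent_diag_pos[OF T(2) symmetric T(3)]) simp
qed

lemma local_norm_dikin_ellipsoid_le:
  assumes x: "pd (\<Lambda> x)" and v: "local_norm \<Lambda> x v < 1"
  shows "local_norm \<Lambda> (x + v) w \<le> local_norm \<Lambda> x w / (1 - local_norm \<Lambda> x v)"
proof -
  define s where "s = local_norm \<Lambda> x v"
  have s: "s < 1" using v by (simp add: s_def)
  obtain T :: "real^'l^'l" and e where T: "transpose T ** \<Lambda> x ** T = mat 1" "invertible T"
      "transpose T ** \<Lambda> (x + v) ** T = diag_mat (\<chi> i. 1 + e $ i)" and e: "\<And>i. 1 - s \<le> 1 + e $ i"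
    unfolding s_def using dikin_congruence[OF x, where v = v] by blast
  have e_pos: "0 < 1 + e $ i" for i using e[of i] s by linarith
  define g where "g = (\<chi> i. 1 / sqrt (1 + e $ i))"
  have "transpose (T ** diag_mat g) ** \<Lambda> (x + v) ** (T ** diag_mat g)
      = diag_mat g ** (transpose T ** \<Lambda> (x + v) ** T) ** diag_mat g"
    by (simp add: matrix_transpose_mul matrix_mul_assoc)
  also have "\<dots> = mat 1"
    using e_pos e_pos[THEN less_imp_neq]
    by (simp add: T(3) diag_mat_mult g_def diag_mat_1[symmetric] vec_eq_iff abs_of_pos)
  finally have "local_norm \<Lambda> (x + v) w
      = norm (transpose (T ** diag_mat g) ** \<Lambda> w ** (T ** diag_mat g))"
    by (rule local_norm_eq[OF pd_dikin_ellipsoid[OF x v]])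
  also have "\<dots> = norm (diag_mat g ** (transpose T ** \<Lambda> w ** T) ** diag_mat g)"
    by (simp add: matrix_transpose_mul matrix_mul_assoc)
  also have "\<dots> \<le> (1 / sqrt (1 - s))\<^sup>2 * norm (transpose T ** \<Lambda> w ** T)"
  proof (rule norm_diag_mat_sandwich_le)
    show "\<bar>g $ i\<bar> \<le> 1 / sqrt (1 - s)" for i
      using e[of i] s by (simp add: g_def frac_le)
  qed
  also have "\<dots> = local_norm \<Lambda> x w / (1 - s)"
    using s by (simp add: local_norm_eq[OF x T(1)] power_divide)
  finally show ?thesis by (simp add: s_def)
qed

lemma local_norm_after_step_le:
  assumes x: "pd (\<Lambda> x)" and d: "local_norm \<Lambda> x d < 1"
  shows "local_norm \<Lambda> (x + d) (x + d - y)
    \<le> (local_norm \<Lambda> x d + local_norm \<Lambda> x (x - y)) / (1 - local_norm \<Lambda> x d)"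
proof -
  have "local_norm \<Lambda> (x + d) (x + d - y) \<le> local_norm \<Lambda> x (d + (x - y)) / (1 - local_norm \<Lambda> x d)"
    using local_norm_dikin_ellipsoid_le[OF x d, of "x + d - y"] by (simp add: algebra_simps)
  also have "\<dots> \<le> (local_norm \<Lambda> x d + local_norm \<Lambda> x (x - y)) / (1 - local_norm \<Lambda> x d)"
    using d by (intro divide_right_mono local_norm_triangle) simp
  finally show ?thesis .
qed

end

lemma perturbed_radius_le:
  fixes r1 r2 s :: real
  assumes "0 \<le> r1" "r1 \<le> r2" "s \<le> (r2 - r1) / (1 + r2)"
  shows "s < 1" "(s + r1) / (1 - s) \<le> r2"
proof -
  have pos: "0 < 1 + r2" using assms(1,2) by linarith
  then have s: "s * (1 + r2) \<le> r2 - r1" using assms(3) by (simp add: pos_le_divide_eq)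
  then have "s * (1 + r2) < 1 + r2" using assms(1) by linarith
  then show "s < 1" using pos by (simp add: mult_less_cancel_right2)
  have "s + r1 \<le> r2 * (1 - s)" using s by (simp add: algebra_simps)
  with \<open>s < 1\<close> show "(s + r1) / (1 - s) \<le> r2" by (simp add: pos_divide_le_eq)
qed

theorem lemma7:
  fixes \<Lambda> :: "real^'u \<Rightarrow> real^'l^'l"
    and t one x y xN :: "real^'u"
    and c r1 r2 :: real and N :: nat
  assumes lin: "linear \<Lambda>"
    and sym: "\<forall>z. transpose (\<Lambda> z) = \<Lambda> z"
    and one_int: "one \<in> interior (primal_cone \<Lambda>)"
    and x_int: "x \<in> dual_cone_int \<Lambda>"
    and y_int: "y \<in> dual_cone_int \<Lambda>"
    and y_grad: "- grad \<Lambda> y = t - c *\<^sub>R one"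
    and r1: "local_norm \<Lambda> x (x - y) \<le> r1" "r1 < 1/2"
    and r12: "r1 \<le> r2"
    and Npos: "0 < N"
    and N_large: "onorm (\<lambda>v. msqrt (hess \<Lambda> x) *v v)
                    \<le> (2 * real N / sqrt (real CARD('u))) * ((r2 - r1) / (1 + r2))"
    and xN_grid: "\<forall>u. real N * (xN $ u) \<in> \<int>"
    and xN_close: "norm (xN - x) \<le> sqrt (real CARD('u)) / (2 * real N)"
  shows "xN \<in> dual_cone_int \<Lambda> \<and> local_norm \<Lambda> xN (xN - y) \<le> r2"
proof -
  interpret symmetric_linear_map \<Lambda> using lin sym by (simp add: symmetric_linear_map_def)
  have x: "pd (\<Lambda> x)" using x_int by (simp add: dual_cone_int_def)
  define s where "s = local_norm \<Lambda> x (xN - x)"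
  have "0 \<le> onorm (\<lambda>v. msqrt (hess \<Lambda> x) *v v)" by (rule onorm_pos_le) simp
  then have "s \<le> (2 * real N / sqrt (real CARD('u)) * ((r2 - r1) / (1 + r2)))
                  * (sqrt (real CARD('u)) / (2 * real N))"
    unfolding s_def using N_large xN_close
    by (intro order_trans[OF local_norm_le_onorm] mult_mono) auto
  then have "s \<le> (r2 - r1) / (1 + r2)" using Npos by simp
  moreover have "0 \<le> r1" using r1(1) local_norm_def by (metis norm_ge_zero order_trans)
  ultimately have s: "s < 1" "(s + r1) / (1 - s) \<le> r2" using perturbed_radius_le r12 by blast+
  have "pd (\<Lambda> xN)" using pd_dikin_ellipsoid[OF x, of "xN - x"] s(1) by (simp add: s_def)
  have "local_norm \<Lambda> xN (xN - y) \<le> (s + local_norm \<Lambda> x (x - y)) / (1 - s)"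
    using local_norm_after_step_le[OF x, of "xN - x" y] s(1) by (simp add: s_def)
  also have "\<dots> \<le> (s + r1) / (1 - s)" using r1(1) s(1) by (simp add: divide_right_mono)
  also note s(2)
  finally show ?thesis using \<open>pd (\<Lambda> xN)\<close> by (simp add: dual_cone_int_def)
qed

end
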